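(* Let $X$ and $Y$ be metric spaces that are coarsely equivalent, and suppose that both $X$ and $Y$ are $\sigma$-stable. Then $\sigma(X)=\sigma(Y)$.
   Context: All metric spaces are nonempty (a basepoint is fixed in each). Coarse equivalence. A function $f:X\to Y$ between metric spaces is bornologous if for each $N>0$ there is an $M>0$ such that $d(x,y)\le N$ implies $d(f(x),f(y))\le M$. It is proper if inverse images of bounded sets are bounded. It is coarse if it is bornologous and proper. Two functions $f_1,f_2$ with the same domain and the same metric space as codomain are close if $d(f_1(x),f_2(x))$ is uniformly bounded over all $x$ in the domain. $X$ and $Y$ are coarsely equivalent if there are coarse functions $f:X\to Y$ and $g:Y\to X$ such that $g\circ f$ is close to $\mathrm{id}_X$ and $f\circ g$ is close to $\mathrm{id}_Y$. The sets $\sigma_N(X,x_0)$. Let $X$ be a metric space with basepoint $x_0\in X$, and let $N>0$. An $N$-sequence in $X$ based at $x_0$ is an infinite sequence $x_0,x_1,x_2,\ldots$ of points of $X$ (starting at $x_0$) with $d(x_i,x_{i+1})\le N$ for all $i\ge 0$. It goes to infinity if $d(x_0,x_i)\to\infty$ as $i\to\infty$. Let $S_N(X,x_0)$ be the set of all $N$-sequences in $X$ based at $x_0$ that go to infinity. Two elements $s,t\in S_N(X,x_0)$ are equivalent if there is a finite list $s_0,\ldots,s_n\in S_N(X,x_0)$ with $s_0=s$, $s_n=t$, and such that for each $0\le i<n$ either $s_{i+1}$ is a subsequence of $s_i$ or $s_i$ is a subsequence of $s_{i+1}$. Let $[s]_N$ denote the equivalence class of $s$, and let $\sigma_N(X,x_0)$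 be the set of equivalence classes. $\sigma$-stability. For each integer $N>0$ let $\phi_N:\sigma_N(X,x_0)\to\sigma_{N+1}(X,x_0)$ be the function $[s]_N\mapsto[s]_{N+1}$. $X$ is $\sigma$-stable with respect to $x_0$ if there is an integer $K>0$ such that $\phi_N$ is a bijection for every integer $N\ge K$; in that case $\sigma(X,x_0)$ denotes the cardinality of $\sigma_K(X,x_0)$ (which does not depend on the choice of such $K$). Being $\sigma$-stable with respect to a basepoint, and the cardinality $\sigma(X,x_0)$, do not depend on the choice of basepoint; so one says simply that $X$ is $\sigma$-stable and writes $\sigma(X)$ for $\sigma(X,x_0)$, for any basepoint $x_0$. *)

theory Defs
  imports "HOL-Analysis.Analysis"
begin

text \<open>Metric spaces are given by a carrier and a distance function, as in the library locale
  \<open>Metric_space\<close>; functions between them matter only on the carriers.\<close>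

subsection \<open>Coarse equivalence\<close>

definition bornologous ::
    "'a set \<Rightarrow> ('a \<Rightarrow> 'a \<Rightarrow> real) \<Rightarrow> ('b \<Rightarrow> 'b \<Rightarrow> real) \<Rightarrow> ('a \<Rightarrow> 'b) \<Rightarrow> bool" where
  "bornologous X dX dY f \<longleftrightarrow>
     (\<forall>N>0. \<exists>M>0. \<forall>x\<in>X. \<forall>y\<in>X. dX x y \<le> N \<longrightarrow> dY (f x) (f y) \<le> M)"

definition metrically_proper ::
    "'a set \<Rightarrow> ('a \<Rightarrow> 'a \<Rightarrow> real) \<Rightarrow> 'b set \<Rightarrow> ('b \<Rightarrow> 'b \<Rightarrow> real) \<Rightarrow> ('a \<Rightarrow> 'b) \<Rightarrow> bool" where
  "metrically_proper X dX Y dY f \<longleftrightarrow>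
     (\<forall>B. Metric_space.mbounded Y dY B \<longrightarrow> Metric_space.mbounded X dX {x \<in> X. f x \<in> B})"

definition coarse_map ::
    "'a set \<Rightarrow> ('a \<Rightarrow> 'a \<Rightarrow> real) \<Rightarrow> 'b set \<Rightarrow> ('b \<Rightarrow> 'b \<Rightarrow> real) \<Rightarrow> ('a \<Rightarrow> 'b) \<Rightarrow> bool" where
  "coarse_map X dX Y dY f \<longleftrightarrow>
     f \<in> X \<rightarrow> Y \<and> bornologous X dX dY f \<and> metrically_proper X dX Y dY f"

definition close_maps ::
    "'a set \<Rightarrow> ('b \<Rightarrow> 'b \<Rightarrow> real) \<Rightarrow> ('a \<Rightarrow> 'b) \<Rightarrow> ('a \<Rightarrow> 'b) \<Rightarrow> bool" where
  "close_maps X dY f1 f2 \<longleftrightarrow> (\<exists>C. \<forall>x\<in>X. dY (f1 x) (f2 x) \<le> C)"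

definition coarsely_equivalent ::
    "'a set \<Rightarrow> ('a \<Rightarrow> 'a \<Rightarrow> real) \<Rightarrow> 'b set \<Rightarrow> ('b \<Rightarrow> 'b \<Rightarrow> real) \<Rightarrow> bool" where
  "coarsely_equivalent X dX Y dY \<longleftrightarrow>
     (\<exists>f g. coarse_map X dX Y dY f \<and> coarse_map Y dY X dX g \<and>
            close_maps X dX (g \<circ> f) id \<and> close_maps Y dY (f \<circ> g) id)"

subsection \<open>The sets $\sigma_N(X,x_0)$\<close>

definition S_seqs :: "'a set \<Rightarrow> ('a \<Rightarrow> 'a \<Rightarrow> real) \<Rightarrow> 'a \<Rightarrow> real \<Rightarrow> (nat \<Rightarrow> 'a) set" where
  "S_seqs X d x0 N =
     {s. range s \<subseteq> X \<and> s 0 = x0 \<and> (\<forall>i. d (s i) (s (Suc i)) \<le> N) \<and>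
         filterlim (\<lambda>i. d x0 (s i)) at_top sequentially}"

definition is_subseq :: "(nat \<Rightarrow> 'a) \<Rightarrow> (nat \<Rightarrow> 'a) \<Rightarrow> bool" where
  "is_subseq t s \<longleftrightarrow> (\<exists>r. strict_mono r \<and> t = s \<circ> r)"

definition subseq_step ::
    "'a set \<Rightarrow> ('a \<Rightarrow> 'a \<Rightarrow> real) \<Rightarrow> 'a \<Rightarrow> real \<Rightarrow> (nat \<Rightarrow> 'a) rel" where
  "subseq_step X d x0 N =
     {(s, t). s \<in> S_seqs X d x0 N \<and> t \<in> S_seqs X d x0 N \<and> (is_subseq t s \<or> is_subseq s t)}"

text \<open>The reflexive transitive closure expresses the existence of a finite list of steps; all
  members of such a list lie in \<open>S_seqs\<close> because each step stays inside it.\<close>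

definition sigma_rel ::
    "'a set \<Rightarrow> ('a \<Rightarrow> 'a \<Rightarrow> real) \<Rightarrow> 'a \<Rightarrow> real \<Rightarrow> (nat \<Rightarrow> 'a) rel" where
  "sigma_rel X d x0 N =
     {(s, t). s \<in> S_seqs X d x0 N \<and> t \<in> S_seqs X d x0 N \<and> (s, t) \<in> (subseq_step X d x0 N)\<^sup>*}"

definition sigma_set ::
    "'a set \<Rightarrow> ('a \<Rightarrow> 'a \<Rightarrow> real) \<Rightarrow> 'a \<Rightarrow> real \<Rightarrow> (nat \<Rightarrow> 'a) set set" where
  "sigma_set X d x0 N = S_seqs X d x0 N // sigma_rel X d x0 N"

lemma equiv_sigma_rel: "equiv (S_seqs X d x0 N) (sigma_rel X d x0 N)"
proof (rule equivI)
  have "sym (subseq_step X d x0 N)"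
    by (auto simp: sym_def subseq_step_def)
  then have "sym ((subseq_step X d x0 N)\<^sup>*)"
    by (rule sym_rtrancl)
  then show "sym (sigma_rel X d x0 N)"
    by (auto simp: sym_def sigma_rel_def)
  show "trans (sigma_rel X d x0 N)"
    by (auto simp: trans_def sigma_rel_def)
qed (auto simp: sigma_rel_def refl_on_def)

subsection \<open>\<open>\<sigma>\<close>-stability\<close>

text \<open>The image of a class $[s]_N$ under the equivalence relation at level $N+1$ is $[s]_{N+1}$;
  see \<open>sigma_phi_class\<close>.\<close>

definition sigma_phi ::
    "'a set \<Rightarrow> ('a \<Rightarrow> 'a \<Rightarrow> real) \<Rightarrow> 'a \<Rightarrow> nat \<Rightarrow> (nat \<Rightarrow> 'a) set \<Rightarrow> (nat \<Rightarrow> 'a) set" where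
  "sigma_phi X d x0 N C = sigma_rel X d x0 (real (N + 1)) `` C"

lemma S_seqs_mono: "N \<le> M \<Longrightarrow> S_seqs X d x0 N \<subseteq> S_seqs X d x0 M"
  unfolding S_seqs_def by (auto intro: order_trans)

lemma sigma_rel_mono:
  assumes "N \<le> M" shows "sigma_rel X d x0 N \<subseteq> sigma_rel X d x0 M"
proof -
  have "subseq_step X d x0 N \<subseteq> subseq_step X d x0 M"
    using S_seqs_mono[OF assms, of X d x0] by (auto simp: subseq_step_def)
  then have "(subseq_step X d x0 N)\<^sup>* \<subseteq> (subseq_step X d x0 M)\<^sup>*"
    by (rule rtrancl_mono)
  then show ?thesis
    using S_seqs_mono[OF assms, of X d x0] by (auto simp: sigma_rel_def)
qed

lemma sigma_phi_class:
  assumes "s \<in> S_seqs X d x0 (real N)"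
  shows "sigma_phi X d x0 N (sigma_rel X d x0 (real N) `` {s}) =
         sigma_rel X d x0 (real (N + 1)) `` {s}"
proof -
  let ?r = "sigma_rel X d x0 (real N)" and ?r' = "sigma_rel X d x0 (real (N + 1))"
  have sub: "?r \<subseteq> ?r'"
    by (rule sigma_rel_mono) simp
  have ss: "(s, s) \<in> ?r"
    using assms by (auto simp: sigma_rel_def)
  have tr: "trans ?r'"
    using equiv_sigma_rel[of X d x0 "real (N + 1)"] unfolding equiv_def by blast
  show ?thesis
    unfolding sigma_phi_def
  proof (intro equalityI subsetI)
    fix u assume "u \<in> ?r' `` (?r `` {s})"
    then obtain t where "(s, t) \<in> ?r" "(t, u) \<in> ?r'"
      by auto
    with sub have "(s, u) \<in> ?r'"
      by (meson subsetD transD[OF tr])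
    then show "u \<in> ?r' `` {s}"
      by simp
  next
    fix u assume "u \<in> ?r' `` {s}"
    with ss show "u \<in> ?r' `` (?r `` {s})"
      by (meson ImageI Image_singleton_iff)
  qed
qed

definition sigma_stable_from ::
    "'a set \<Rightarrow> ('a \<Rightarrow> 'a \<Rightarrow> real) \<Rightarrow> 'a \<Rightarrow> nat \<Rightarrow> bool" where
  "sigma_stable_from X d x0 K \<longleftrightarrow>
     K > 0 \<and>
     (\<forall>N\<ge>K. bij_betw (sigma_phi X d x0 N)
              (sigma_set X d x0 (real N)) (sigma_set X d x0 (real (N + 1))))"

definition sigma_stable_at :: "'a set \<Rightarrow> ('a \<Rightarrow> 'a \<Rightarrow> real) \<Rightarrow> 'a \<Rightarrow> bool" where
  "sigma_stable_at X d x0 \<longleftrightarrow> (\<exists>K. sigma_stable_from X d x0 K)"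

text \<open>Stability does not depend on the basepoint, so demanding it at some basepoint is the same
  as demanding it at all of them.\<close>

definition sigma_stable :: "'a set \<Rightarrow> ('a \<Rightarrow> 'a \<Rightarrow> real) \<Rightarrow> bool" where
  "sigma_stable X d \<longleftrightarrow> (\<exists>x0\<in>X. sigma_stable_at X d x0)"

text \<open>The cardinal \<open>\<sigma>(X,x0)\<close>, possibly infinite, is a library cardinal; equality of cardinals is
  membership in \<open>ordIso\<close>, since the two sides may have different types.  The least admissible
  \<open>K\<close> is used; by \<open>sigma_card_eq\<close> any other choice gives the same cardinal.\<close>

definition sigma_card :: "'a set \<Rightarrow> ('a \<Rightarrow> 'a \<Rightarrow> real) \<Rightarrow> 'a \<Rightarrow> (nat \<Rightarrow> 'a) set rel" where
  "sigma_card X d x0 =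
     card_of (sigma_set X d x0 (real (LEAST K. sigma_stable_from X d x0 K)))"

lemma sigma_card_eq:
  assumes "sigma_stable_from X d x0 K"
  shows "(sigma_card X d x0, card_of (sigma_set X d x0 (real K))) \<in> ordIso"
proof -
  define L where "L = (LEAST K. sigma_stable_from X d x0 K)"
  have "sigma_stable_from X d x0 L"
    unfolding L_def by (rule LeastI[of _ K]) (rule assms)
  then have bij: "bij_betw (sigma_phi X d x0 n)
      (sigma_set X d x0 (real n)) (sigma_set X d x0 (real (n + 1)))" if "L \<le> n" for n
    using that unfolding sigma_stable_from_def by blast
  have "(card_of (sigma_set X d x0 (real L)), card_of (sigma_set X d x0 (real m))) \<in> ordIso"
    if "L \<le> m" for m
    using that
  proof (induction m rule: dec_induct)
    case base
    show ?case by (rule card_of_refl)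
  next
    case (step n)
    have "(card_of (sigma_set X d x0 (real n)), card_of (sigma_set X d x0 (real (Suc n))))
        \<in> ordIso"
      using card_of_ordIsoI[OF bij[OF step.hyps(1)]] by (simp only: Suc_eq_plus1)
    with step.IH show ?case
      by (rule ordIso_transitive)
  qed
  moreover have "L \<le> K"
    unfolding L_def by (rule Least_le) (rule assms)
  ultimately show ?thesis
    unfolding sigma_card_def L_def[symmetric] by blast
qed

end

theory Submission
  imports Defs
begin

text \<open>A coarse map \<open>f\<close> sends an \<open>N\<close>-sequence \<open>s\<close> to the sequence obtained from \<open>f \<circ> s\<close> by
  prepending the basepoint of the target.  This respects subsequences, hence equivalence.  Going
  forth and back by a coarse equivalence moves a sequence by a bounded amount, and two sequences
  at bounded distance are both subsequences of their interleaving.  So if the images of \<open>s\<close> and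
  \<open>t\<close> are equivalent then \<open>s\<close> and \<open>t\<close> are equivalent at some higher level, and by stability they
  were equivalent already.  This gives injections between the stable sets in both directions, and
  the Schroeder-Bernstein theorem concludes.  The case of the identity map shows that
  stability does not depend on the basepoint.\<close>

section \<open>Equivalence of sequences at a fixed level\<close>

lemma sigma_rel_refl: "s \<in> S_seqs X d x0 N \<Longrightarrow> (s, s) \<in> sigma_rel X d x0 N"
  by (simp add: sigma_rel_def)

lemma sigma_rel_sym: "(s, t) \<in> sigma_rel X d x0 N \<Longrightarrow> (t, s) \<in> sigma_rel X d x0 N"
  by (meson equiv_sigma_rel equivE symD)

lemma sigma_rel_trans:
  "(s, t) \<in> sigma_rel X d x0 N \<Longrightarrow> (t, u) \<in> sigma_rel X d x0 N \<Longrightarrow> (s, u) \<in> sigma_rel X d x0 N"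
  by (meson equiv_sigma_rel equivE transD)

lemma sigma_rel_in:
  assumes "(s, t) \<in> sigma_rel X d x0 N"
  shows "s \<in> S_seqs X d x0 N" and "t \<in> S_seqs X d x0 N"
  using assms by (auto simp: sigma_rel_def)

lemma sigma_rel_subseqI:
  assumes "s \<in> S_seqs X d x0 N" "t \<in> S_seqs X d x0 N" "is_subseq t s"
  shows "(s, t) \<in> sigma_rel X d x0 N"
  using assms by (auto simp: sigma_rel_def subseq_step_def)

section \<open>Pushing sequences forward along a proper map\<close>

lemma strict_mono_case_nat_Suc:
  assumes "strict_mono r"
  shows "strict_mono (case_nat 0 (Suc \<circ> r))"
  unfolding strict_mono_Suc_iff
proof
  fix n show "case_nat 0 (Suc \<circ> r) n < case_nat 0 (Suc \<circ> r) (Suc n)"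
    using assms by (cases n) (auto simp: strict_mono_Suc_iff)
qed

lemma is_subseq_case_nat:
  assumes "is_subseq t s"
  shows "is_subseq (case_nat y (f \<circ> t)) (case_nat y (f \<circ> s))"
proof -
  from assms obtain r where r: "strict_mono r" "t = s \<circ> r"
    by (auto simp: is_subseq_def)
  \<comment> \<open>The reindexing fixes position 0, which holds the prepended point, and acts as
    \<open>r\<close> on the tail shifted by one.\<close>
  have "case_nat y (f \<circ> t) = case_nat y (f \<circ> s) \<circ> case_nat 0 (Suc \<circ> r)"
    by (auto simp: r(2) split: nat.split)
  with strict_mono_case_nat_Suc[OF r(1)] show ?thesis
    unfolding is_subseq_def by blast
qed

lemma metrically_proper_id:
  assumes "Metric_space X d"
  shows "metrically_proper X d X d id"
proof -
  interpret Metric_space X d by fact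
  show ?thesis
    unfolding metrically_proper_def by (auto elim: mbounded_subset)
qed

text \<open>A ball around \<open>y0\<close> pulls back to a bounded set of \<open>X\<close>, and a
  sequence going to infinity eventually leaves that set for good.\<close>

lemma filterlim_proper_image:
  assumes X: "Metric_space X dX" and Y: "Metric_space Y dY"
    and "x0 \<in> X" "y0 \<in> Y" "f \<in> X \<rightarrow> Y" and proper: "metrically_proper X dX Y dY f"
    and s: "range s \<subseteq> X" and lim: "filterlim (\<lambda>i. dX x0 (s i)) at_top sequentially"
  shows "filterlim (\<lambda>i. dY y0 (f (s i))) at_top sequentially"
  unfolding filterlim_at_top
proof
  interpret MX: Metric_space X dX by fact
  interpret MY: Metric_space Y dY by fact
  fix R :: real
  have "MX.mbounded {x \<in> X. f x \<in> MY.mcball y0 R}"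
    using proper MY.mbounded_mcball unfolding metrically_proper_def by blast
  then obtain a B where aB: "{x \<in> X. f x \<in> MY.mcball y0 R} \<subseteq> MX.mcball a B"
    unfolding MX.mbounded_def by blast
  \<comment> \<open>Points of \<open>MX.mcball a B\<close> lie within \<open>dX x0 a + B\<close> of
    \<open>x0\<close>; the extra 1 makes the contradiction strict.\<close>
  have "eventually (\<lambda>i. dX x0 a + B + 1 \<le> dX x0 (s i)) sequentially"
    using lim by (simp add: filterlim_at_top)
  then show "eventually (\<lambda>i. R \<le> dY y0 (f (s i))) sequentially"
  proof eventually_elim
    case (elim i)
    show ?case
    proof (rule ccontr)
      assume "\<not> R \<le> dY y0 (f (s i))"
      moreover have "s i \<in> X" "f (s i) \<in> Y"
        using s \<open>f \<in> X \<rightarrow> Y\<close> by auto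
      ultimately have "s i \<in> MX.mcball a B"
        using aB \<open>y0 \<in> Y\<close> by auto
      then show False
        using elim MX.triangle[of x0 a "s i"] \<open>x0 \<in> X\<close> by auto
    qed
  qed
qed

text \<open>Since \<open>f x0\<close> may differ from \<open>y0\<close>, the point \<open>y0\<close>
  is prepended. The one new step, from \<open>y0\<close> to \<open>f x0\<close>, is controlled by
  \<open>base\<close>; the other steps are images of steps of \<open>s\<close>.\<close>

lemma S_seqs_case_nat:
  assumes X: "Metric_space X dX" and Y: "Metric_space Y dY"
    and "x0 \<in> X" "y0 \<in> Y" "f \<in> X \<rightarrow> Y" and proper: "metrically_proper X dX Y dY f"
    and bd: "\<forall>x\<in>X. \<forall>x'\<in>X. dX x x' \<le> N \<longrightarrow> dY (f x) (f x') \<le> M"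
    and base: "dY y0 (f x0) \<le> M"
    and s: "s \<in> S_seqs X dX x0 N"
  shows "case_nat y0 (f \<circ> s) \<in> S_seqs Y dY y0 M"
proof -
  have sX: "\<And>i. s i \<in> X" and s0: "s 0 = x0" and step: "\<And>i. dX (s i) (s (Suc i)) \<le> N"
    and lim: "filterlim (\<lambda>i. dX x0 (s i)) at_top sequentially"
    using s by (auto simp: S_seqs_def)
  have "filterlim (\<lambda>i. dY y0 (f (s i))) at_top sequentially"
    using filterlim_proper_image[OF assms(1-6) _ lim] sX by auto
  then have "filterlim (\<lambda>i. dY y0 (case_nat y0 (f \<circ> s) (Suc i))) at_top sequentially"
    by simp
  then have "filterlim (\<lambda>i. dY y0 (case_nat y0 (f \<circ> s) i)) at_top sequentially"
    by (subst (asm) filterlim_sequentially_Suc)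
  moreover have "dY (case_nat y0 (f \<circ> s) i) (case_nat y0 (f \<circ> s) (Suc i)) \<le> M" for i
    using base bd sX step s0 by (cases i) auto
  moreover have "case_nat y0 (f \<circ> s) i \<in> Y" for i
    using funcset_mem[OF \<open>f \<in> X \<rightarrow> Y\<close> sX] \<open>y0 \<in> Y\<close> by (simp split: nat.split)
  ultimately show ?thesis
    by (auto simp: S_seqs_def)
qed

text \<open>Induction along the chain of subsequence steps: prepending preserves the subsequence
  relation, in whichever direction a step goes.\<close>

lemma sigma_rel_case_nat:
  assumes "Metric_space X dX" "Metric_space Y dY"
    and "x0 \<in> X" "y0 \<in> Y" "f \<in> X \<rightarrow> Y" "metrically_proper X dX Y dY f"
    and "\<forall>x\<in>X. \<forall>x'\<in>X. dX x x' \<le> N \<longrightarrow> dY (f x) (f x') \<le> M"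
    and "dY y0 (f x0) \<le> M"
    and st: "(s, t) \<in> sigma_rel X dX x0 N"
  shows "(case_nat y0 (f \<circ> s), case_nat y0 (f \<circ> t)) \<in> sigma_rel Y dY y0 M"
proof -
  note S = S_seqs_case_nat[OF assms(1-8)]
  have "(s, t) \<in> (subseq_step X dX x0 N)\<^sup>*" "s \<in> S_seqs X dX x0 N"
    using st by (auto simp: sigma_rel_def)
  then show ?thesis
  proof (induction rule: rtrancl_induct)
    case base
    then show ?case by (intro sigma_rel_refl S)
  next
    case (step t u)
    then have "(case_nat y0 (f \<circ> t), case_nat y0 (f \<circ> u)) \<in> sigma_rel Y dY y0 M"
      unfolding subseq_step_def
      by (auto intro: sigma_rel_subseqI sigma_rel_sym S is_subseq_case_nat)
    with step show ?case
      by (blast intro: sigma_rel_trans)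
  qed
qed

section \<open>Discarding initial points and interleaving\<close>

lemma is_subseq_drop2: "is_subseq s (case_nat a (case_nat b s))"
  unfolding is_subseq_def
  by (rule exI[of _ "\<lambda>i. Suc (Suc i)"]) (auto simp: strict_mono_def)

text \<open>Both sequences are subsequences of s_0, t_0, s_1, t_1, ... The level doubles because the
  step from t_i to s_(i+1) is bounded by a detour through s_i.\<close>

lemma sigma_rel_close:
  assumes "Metric_space X d"
    and s: "s \<in> S_seqs X d x0 N" and t: "t \<in> S_seqs X d x0 N"
    and close: "\<And>i. d (s i) (t i) \<le> N"
  shows "(s, t) \<in> sigma_rel X d x0 (2 * N)"
proof -
  interpret Metric_space X d by fact
  define u where "u i = (if even i then s (i div 2) else t (i div 2))" for i
  have s': "\<And>i. s i \<in> X" "s 0 = x0" "\<And>i. d (s i) (s (Suc i)) \<le> N"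
    and lims: "filterlim (\<lambda>i. d x0 (s i)) at_top sequentially"
    using s by (auto simp: S_seqs_def)
  have t': "\<And>i. t i \<in> X" and limt: "filterlim (\<lambda>i. d x0 (t i)) at_top sequentially"
    using t by (auto simp: S_seqs_def)
  have N: "0 \<le> N"
    using close[of 0] nonneg[of "s 0" "t 0"] by linarith
  have ts: "d (t i) (s (Suc i)) \<le> 2 * N" for i
    using triangle[of "t i" "s i" "s (Suc i)"] close[of i] s' t' commute[of "t i" "s i"]
    by (smt (verit))
  have "d (u i) (u (Suc i)) \<le> 2 * N" for i
  proof (cases "even i")
    case True
    then show ?thesis
      using close[of "i div 2"] N by (simp add: u_def)
  next
    case False
    then show ?thesis
      using ts[of "i div 2"] by (simp add: u_def)
  qed
  moreover have "filterlim (\<lambda>i. d x0 (u i)) at_top sequentially"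
    unfolding filterlim_at_top eventually_sequentially
  proof
    fix Z
    obtain a b where "\<And>i. i \<ge> a \<Longrightarrow> Z \<le> d x0 (s i)" "\<And>i. i \<ge> b \<Longrightarrow> Z \<le> d x0 (t i)"
      using lims limt unfolding filterlim_at_top eventually_sequentially by metis
    \<comment> \<open>From this index on, \<open>i div 2\<close> is at least both \<open>a\<close>
      and \<open>b\<close>.\<close>
    then have "\<forall>i\<ge>2 * max a b. Z \<le> d x0 (u i)"
      by (auto simp: u_def)
    then show "\<exists>n. \<forall>i\<ge>n. Z \<le> d x0 (u i)" ..
  qed
  ultimately have u: "u \<in> S_seqs X d x0 (2 * N)"
    using s' t' by (auto simp: S_seqs_def u_def)
  have "is_subseq s u"
    unfolding is_subseq_def
    by (rule exI[of _ "\<lambda>i. 2 * i"]) (auto simp: strict_mono_def u_def)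
  moreover have "is_subseq t u"
    unfolding is_subseq_def
    by (rule exI[of _ "\<lambda>i. 2 * i + 1"]) (auto simp: strict_mono_def u_def)
  moreover have "s \<in> S_seqs X d x0 (2 * N)" "t \<in> S_seqs X d x0 (2 * N)"
    using s t N S_seqs_mono[of N "2 * N" X d x0] by auto
  ultimately show ?thesis
    using u by (blast intro: sigma_rel_subseqI sigma_rel_sym sigma_rel_trans)
qed

section \<open>Stability in terms of representatives\<close>

lemma image_eq_image_subset_iff:
  assumes "A \<subseteq> B"
  shows "f ` A = f ` B \<longleftrightarrow> (\<forall>b\<in>B. \<exists>a\<in>A. f a = f b)"
proof -
  have "f ` A = f ` B \<longleftrightarrow> f ` B \<subseteq> f ` A"
    by (simp add: set_eq_subset image_mono[OF assms])
  also have "\<dots> \<longleftrightarrow> (\<forall>b\<in>B. \<exists>a\<in>A. f a = f b)"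
    unfolding image_subset_iff image_iff by (intro ball_cong bex_cong refl eq_commute)
  finally show ?thesis .
qed

text \<open>Replaces classes by representatives. The first conjunct is injectivity: no new
  identifications among \<open>N\<close>-sequences. The second is surjectivity: each sequence of the
  next level is equivalent there to an \<open>N\<close>-sequence.\<close>

lemma bij_betw_sigma_phi_iff:
  "bij_betw (sigma_phi X d x0 N) (sigma_set X d x0 (real N)) (sigma_set X d x0 (real (N + 1))) \<longleftrightarrow>
     (\<forall>s\<in>S_seqs X d x0 (real N). \<forall>t\<in>S_seqs X d x0 (real N).
        (s, t) \<in> sigma_rel X d x0 (real (N + 1)) \<longrightarrow> (s, t) \<in> sigma_rel X d x0 (real N)) \<and>
     (\<forall>u\<in>S_seqs X d x0 (real (N + 1)). \<exists>s\<in>S_seqs X d x0 (real N).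
        (s, u) \<in> sigma_rel X d x0 (real (N + 1)))"
  (is "_ \<longleftrightarrow> ?inj \<and> ?surj")
proof -
  let ?S = "S_seqs X d x0 (real N)" and ?S' = "S_seqs X d x0 (real (N + 1))"
  let ?r = "sigma_rel X d x0 (real N)" and ?r' = "sigma_rel X d x0 (real (N + 1))"
  let ?phi = "sigma_phi X d x0 N"
  have sub: "?S \<subseteq> ?S'"
    by (rule S_seqs_mono) simp
  have eq: "?r `` {s} = ?r `` {t} \<longleftrightarrow> (s, t) \<in> ?r" if "s \<in> ?S" "t \<in> ?S" for s t
    by (rule eq_equiv_class_iff[OF equiv_sigma_rel that])
  have eq': "?r' `` {s} = ?r' `` {t} \<longleftrightarrow> (s, t) \<in> ?r'" if "s \<in> ?S'" "t \<in> ?S'" for s t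
    by (rule eq_equiv_class_iff[OF equiv_sigma_rel that])
  have Q: "sigma_set X d x0 (real N) = (\<lambda>s. ?r `` {s}) ` ?S"
    "sigma_set X d x0 (real (N + 1)) = (\<lambda>s. ?r' `` {s}) ` ?S'"
    by (auto simp: sigma_set_def quotient_def)
  have im: "?phi ` (\<lambda>s. ?r `` {s}) ` ?S = (\<lambda>s. ?r' `` {s}) ` ?S"
    by (auto simp: image_image sigma_phi_class intro!: image_cong)
  have "inj_on ?phi ((\<lambda>s. ?r `` {s}) ` ?S) \<longleftrightarrow> ?inj"
    unfolding inj_on_def ball_simps
  proof (intro ball_cong refl)
    fix s t assume st: "s \<in> ?S" "t \<in> ?S"
    then show "(?phi (?r `` {s}) = ?phi (?r `` {t}) \<longrightarrow> ?r `` {s} = ?r `` {t}) \<longleftrightarrow>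
        ((s, t) \<in> ?r' \<longrightarrow> (s, t) \<in> ?r)"
      using st sub by (simp only: sigma_phi_class eq eq' subsetD)
  qed
  moreover have "(\<lambda>s. ?r' `` {s}) ` ?S = (\<lambda>s. ?r' `` {s}) ` ?S' \<longleftrightarrow> ?surj"
    unfolding image_eq_image_subset_iff[OF sub] using sub
    by (intro ball_cong bex_cong refl eq') (rule subsetD)
  ultimately show ?thesis
    unfolding bij_betw_def Q im by simp
qed

text \<open>Injectivity lowers the level of an equivalence by one at a time; \<open>s\<close> and
  \<open>t\<close> belong to every intermediate level.\<close>

lemma sigma_stable_from_inj:
  assumes K: "sigma_stable_from X d x0 K" and "K \<le> n"
    and st: "s \<in> S_seqs X d x0 (real K)" "t \<in> S_seqs X d x0 (real K)"
    and rel: "(s, t) \<in> sigma_rel X d x0 (real n)"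
  shows "(s, t) \<in> sigma_rel X d x0 (real K)"
  using \<open>K \<le> n\<close> rel
proof (induction n rule: dec_induct)
  case (step n)
  have "s \<in> S_seqs X d x0 (real n)" "t \<in> S_seqs X d x0 (real n)"
    using st S_seqs_mono[of "real K" "real n" X d x0] step.hyps by auto
  moreover have "bij_betw (sigma_phi X d x0 n)
      (sigma_set X d x0 (real n)) (sigma_set X d x0 (real (n + 1)))"
    using K step.hyps unfolding sigma_stable_from_def by blast
  ultimately have "(s, t) \<in> sigma_rel X d x0 (real n)"
    using step.prems unfolding bij_betw_sigma_phi_iff by (metis Suc_eq_plus1)
  then show ?case by (rule step.IH)
qed

lemma sigma_stable_from_mono:
  "sigma_stable_from X d x0 K \<Longrightarrow> K \<le> L \<Longrightarrow> sigma_stable_from X d x0 L"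
  unfolding sigma_stable_from_def by auto

section \<open>Independence of the basepoint\<close>

lemma sigma_rel_change_base:
  assumes "Metric_space X d" "x \<in> X" "y \<in> X" "d y x \<le> N"
    and "(s, t) \<in> sigma_rel X d x N"
  shows "(case_nat y s, case_nat y t) \<in> sigma_rel X d y N"
  using sigma_rel_case_nat[OF assms(1,1-3) _ metrically_proper_id[OF assms(1)], of N N s t]
    assms
  by auto

text \<open>The round trip merely puts two points in front of \<open>s\<close>, so \<open>s\<close>
  is a subsequence of the result.\<close>

lemma sigma_rel_change_base_twice:
  assumes "Metric_space X d" "x \<in> X" "y \<in> X" "d y x \<le> N" and s: "s \<in> S_seqs X d x N"
  shows "(case_nat x (case_nat y s), s) \<in> sigma_rel X d x N"
proof -
  have "d x y \<le> N"
    using assms by (metis Metric_space.commute)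
  have "(case_nat y s, case_nat y s) \<in> sigma_rel X d y N"
    using sigma_rel_change_base assms sigma_rel_refl by metis
  then have "(case_nat x (case_nat y s), case_nat x (case_nat y s)) \<in> sigma_rel X d x N"
    using sigma_rel_change_base assms \<open>d x y \<le> N\<close> by metis
  then have "case_nat x (case_nat y s) \<in> S_seqs X d x N"
    by (rule sigma_rel_in)
  then show ?thesis
    by (rule sigma_rel_subseqI[OF _ s is_subseq_drop2])
qed

text \<open>Once \<open>N\<close> is at least the distance of the basepoints, changing base
  preserves the level and is undone, up to equivalence, by changing back. Both conditions of
  \<open>bij_betw_sigma_phi_iff\<close> therefore transfer.\<close>

lemma sigma_stable_at_change_base:
  assumes M: "Metric_space X d" and x: "x \<in> X" and y: "y \<in> X" and st: "sigma_stable_at X d x"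
  shows "sigma_stable_at X d y"
proof -
  obtain K where K: "sigma_stable_from X d x K"
    using st unfolding sigma_stable_at_def by blast
  obtain c :: nat where c: "d x y \<le> real c"
    using real_arch_simple by blast
  have "bij_betw (sigma_phi X d y N) (sigma_set X d y (real N)) (sigma_set X d y (real (N + 1)))"
    if N: "max K c \<le> N" for N
  proof -
    let ?R = "sigma_rel X d"
    have dN: "d x y \<le> real N" "d y x \<le> real N" "d x y \<le> real (N + 1)" "d y x \<le> real (N + 1)"
      using c N by (auto simp: Metric_space.commute[OF M, of y x])
    note xy = sigma_rel_change_base[OF M x y] and yx = sigma_rel_change_base[OF M y x]
      and undo = sigma_rel_change_base_twice[OF M y x]
    have bij: "bij_betw (sigma_phi X d x N)
        (sigma_set X d x (real N)) (sigma_set X d x (real (N + 1)))"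
      using K N unfolding sigma_stable_from_def by auto
    show ?thesis
      unfolding bij_betw_sigma_phi_iff
    proof (intro conjI ballI impI)
      fix s t
      assume st: "s \<in> S_seqs X d y (real N)" "t \<in> S_seqs X d y (real N)"
        and rel: "(s, t) \<in> ?R y (real (N + 1))"
      have "case_nat x s \<in> S_seqs X d x (real N)" "case_nat x t \<in> S_seqs X d x (real N)"
        using st yx[OF dN(1)] by (blast intro: sigma_rel_in sigma_rel_refl)+
      with yx[OF dN(3) rel] have "(case_nat x s, case_nat x t) \<in> ?R x (real N)"
        using bij unfolding bij_betw_sigma_phi_iff by blast
      from xy[OF dN(2) this] show "(s, t) \<in> ?R y (real N)"
        using undo[OF dN(1)] st by (blast intro: sigma_rel_sym sigma_rel_trans)
    next
      fix u assume u: "u \<in> S_seqs X d y (real (N + 1))"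
      have "case_nat x u \<in> S_seqs X d x (real (N + 1))"
        using u yx[OF dN(3)] by (blast intro: sigma_rel_in sigma_rel_refl)
      then obtain s where s: "s \<in> S_seqs X d x (real N)"
        and rel: "(s, case_nat x u) \<in> ?R x (real (N + 1))"
        using bij unfolding bij_betw_sigma_phi_iff by blast
      have "case_nat y s \<in> S_seqs X d y (real N)"
        using s xy[OF dN(2)] by (blast intro: sigma_rel_in sigma_rel_refl)
      moreover have "(case_nat y s, u) \<in> ?R y (real (N + 1))"
        using xy[OF dN(4) rel] undo[OF dN(3) u] by (blast intro: sigma_rel_trans)
      ultimately show "\<exists>s\<in>S_seqs X d y (real N). (s, u) \<in> ?R y (real (N + 1))"
        by blast
    qed
  qed
  then have "sigma_stable_from X d y (max K c)"
    using K by (auto simp: sigma_stable_from_def)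
  then show ?thesis
    unfolding sigma_stable_at_def by blast
qed

section \<open>Comparison of cardinals along a coarse equivalence\<close>

lemma bornologous_nat_bound:
  assumes "bornologous X dX dY f"
  obtains m :: nat where
    "\<And>x x'. x \<in> X \<Longrightarrow> x' \<in> X \<Longrightarrow> dX x x' \<le> real n \<Longrightarrow> dY (f x) (f x') \<le> real m"
proof -
  \<comment> \<open>\<open>bornologous\<close> speaks of positive bounds only; adding 1 covers
    \<open>n\<close> = 0.\<close>
  have "0 < real n + 1"
    by simp
  then obtain M where M: "\<And>x x'. x \<in> X \<Longrightarrow> x' \<in> X \<Longrightarrow> dX x x' \<le> real n + 1 \<Longrightarrow> dY (f x) (f x') \<le> M"
    using assms unfolding bornologous_def by metis
  obtain m :: nat where "M \<le> real m"
    using real_arch_simple by blast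
  then show ?thesis
    using M by (intro that[of m]) force
qed

text \<open>At stable levels \<open>K\<close> and \<open>L\<close>, the map [s]_K to [F s]_L induced
  by \<open>f\<close> is injective, because \<open>g\<close> recovers \<open>s\<close> up to
  equivalence at a higher level.\<close>

lemma sigma_card_le:
  assumes X: "Metric_space X dX" and Y: "Metric_space Y dY"
    and x0: "x0 \<in> X" and y0: "y0 \<in> Y"
    and f: "coarse_map X dX Y dY f" and g: "coarse_map Y dY X dX g"
    and close: "close_maps X dX (g \<circ> f) id"
    and stX: "sigma_stable_at X dX x0" and stY: "sigma_stable_at Y dY y0"
  shows "(sigma_card X dX x0, sigma_card Y dY y0) \<in> ordLeq"
proof -
  interpret MX: Metric_space X dX by fact
  obtain K where K: "sigma_stable_from X dX x0 K"
    using stX unfolding sigma_stable_at_def by blast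
  obtain L0 where L0: "sigma_stable_from Y dY y0 L0"
    using stY unfolding sigma_stable_at_def by blast
  obtain m where m: "\<And>x x'. x \<in> X \<Longrightarrow> x' \<in> X \<Longrightarrow> dX x x' \<le> real K \<Longrightarrow> dY (f x) (f x') \<le> real m"
    using bornologous_nat_bound f unfolding coarse_map_def by metis
  obtain b :: nat where b: "dY y0 (f x0) \<le> real b"
    using real_arch_simple by blast
  \<comment> \<open>\<open>L0\<close> gives stability, \<open>m\<close> bounds the images of
    \<open>K\<close>-steps, and \<open>b\<close> bounds the step from \<open>y0\<close> to
    \<open>f x0\<close>.\<close>
  define L where "L = Max {L0, m, b}"
  have LL: "L0 \<le> L" "m \<le> L" "b \<le> L"
    by (auto simp: L_def)
  have L: "sigma_stable_from Y dY y0 L"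
    using L0 LL by (blast intro: sigma_stable_from_mono)
  have fL: "\<forall>x\<in>X. \<forall>x'\<in>X. dX x x' \<le> real K \<longrightarrow> dY (f x) (f x') \<le> real L"
    using m LL by (meson of_nat_mono order_trans)
  have bL: "dY y0 (f x0) \<le> real L"
    using b LL by simp
  have fX: "f \<in> X \<rightarrow> Y" "metrically_proper X dX Y dY f"
    and gY: "g \<in> Y \<rightarrow> X" "metrically_proper Y dY X dX g"
    using f g by (auto simp: coarse_map_def)
  obtain p where p: "\<And>y y'. y \<in> Y \<Longrightarrow> y' \<in> Y \<Longrightarrow> dY y y' \<le> real L \<Longrightarrow> dX (g y) (g y') \<le> real p"
    using bornologous_nat_bound g unfolding coarse_map_def by metis
  obtain c :: nat where c: "dX x0 (g y0) \<le> real c"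
    using real_arch_simple by blast
  obtain C where C: "\<And>x. x \<in> X \<Longrightarrow> dX (g (f x)) x \<le> C"
    using close unfolding close_maps_def by auto
  obtain e :: nat where e: "C \<le> real e"
    using real_arch_simple by blast
  \<comment> \<open>\<open>K\<close> makes \<open>s\<close> itself a \<open>P\<close>-sequence,
    \<open>p\<close> and \<open>c\<close> let \<open>g\<close> carry \<open>L\<close>-sequences to
    \<open>P\<close>-sequences, and \<open>e\<close> bounds the displacement under
    \<open>g \<circ> f\<close>.\<close>
  define P where "P = Max {K, p, c, e}"
  have PP: "K \<le> P" "p \<le> P" "c \<le> P" "e \<le> P"
    by (auto simp: P_def)
  have gP: "\<forall>y\<in>Y. \<forall>y'\<in>Y. dY y y' \<le> real L \<longrightarrow> dX (g y) (g y') \<le> real P"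
    using p PP by (meson of_nat_mono order_trans)
  have cP: "dX x0 (g y0) \<le> real P"
    using c PP by simp
  let ?F = "\<lambda>s. case_nat y0 (f \<circ> s)" and ?G = "\<lambda>s. case_nat x0 (g \<circ> s)"
  let ?S = "S_seqs X dX x0 (real K)" and ?r = "sigma_rel X dX x0 (real K)"
  let ?T = "S_seqs Y dY y0 (real L)" and ?q = "sigma_rel Y dY y0 (real L)"
  note FS = S_seqs_case_nat[OF X Y x0 y0 fX fL bL]
    and Frel = sigma_rel_case_nat[OF X Y x0 y0 fX fL bL]
    and GS = S_seqs_case_nat[OF Y X y0 x0 gY gP cP]
    and Grel = sigma_rel_case_nat[OF Y X y0 x0 gY gP cP]
  \<comment> \<open>The sequence \<open>?G (?F s)\<close> reads x0, g y0, g (f s_0), ... Its indices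
    are two ahead of those of \<open>s\<close>, so it is compared termwise with x0, x0, s_0, s_1,
    ..., of which \<open>s\<close> is a subsequence. The factor 2 is the cost of
    interleaving.\<close>
  have undo: "(?G (?F s), s) \<in> sigma_rel X dX x0 (real (2 * P))" if s: "s \<in> ?S" for s
  proof -
    have sP: "s \<in> S_seqs X dX x0 (real P)"
      using s S_seqs_mono[of "real K" "real P" X dX x0] PP by auto
    have sX: "s i \<in> X" for i
      using s by (auto simp: S_seqs_def)
    have gf: "dX (g (f (s i))) (s i) \<le> real P" for i
      using C[OF sX[of i]] e PP by simp
    have delay: "(case_nat x0 (case_nat x0 s), s) \<in> sigma_rel X dX x0 (real P)"
      using sigma_rel_change_base_twice[OF X x0 x0 _ sP] x0 by simp
    have "dX (?G (?F s) i) (case_nat x0 (case_nat x0 s) i) \<le> real P" for i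
      using gf cP x0 by (auto simp: MX.commute[of "g y0"] split: nat.split)
    then have "(?G (?F s), case_nat x0 (case_nat x0 s)) \<in> sigma_rel X dX x0 (2 * real P)"
      using sigma_rel_close[OF X GS[OF FS[OF s]] sigma_rel_in(1)[OF delay]] by blast
    moreover have "(case_nat x0 (case_nat x0 s), s) \<in> sigma_rel X dX x0 (2 * real P)"
      using delay sigma_rel_mono[of "real P" "2 * real P" X dX x0] by auto
    ultimately show ?thesis
      by (auto intro: sigma_rel_trans)
  qed
  \<comment> \<open>Applying \<open>g\<close> gives an equivalence at level \<open>2 * P\<close>,
    which stability of \<open>X\<close> brings down to \<open>K\<close>.\<close>
  have inj: "(s, t) \<in> ?r" if st: "s \<in> ?S" "t \<in> ?S" and rel: "(?F s, ?F t) \<in> ?q" for s t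
  proof -
    have "(?G (?F s), ?G (?F t)) \<in> sigma_rel X dX x0 (real (2 * P))"
      using Grel[OF rel] sigma_rel_mono[of "real P" "real (2 * P)" X dX x0] by auto
    with undo[OF st(1)] undo[OF st(2)] have "(s, t) \<in> sigma_rel X dX x0 (real (2 * P))"
      by (blast intro: sigma_rel_sym sigma_rel_trans)
    then show ?thesis
      using sigma_stable_from_inj[OF K _ st, of "2 * P"] PP by simp
  qed
  \<comment> \<open>Saturating the image of a whole class avoids choosing a representative;
    \<open>h\<close> shows that the result is a single class.\<close>
  let ?h = "\<lambda>A. ?q `` (?F ` A)"
  have h: "?h (?r `` {s}) = ?q `` {?F s}" if s: "s \<in> ?S" for s
  proof
    show "?h (?r `` {s}) \<subseteq> ?q `` {?F s}"
      using Frel by (blast intro: sigma_rel_trans)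
    show "?q `` {?F s} \<subseteq> ?h (?r `` {s})"
      using sigma_rel_refl[OF s] by blast
  qed
  have "inj_on ?h (sigma_set X dX x0 (real K))"
  proof (rule inj_onI)
    fix A B
    assume "A \<in> sigma_set X dX x0 (real K)" "B \<in> sigma_set X dX x0 (real K)"
    then obtain s t where st: "s \<in> ?S" "t \<in> ?S" "A = ?r `` {s}" "B = ?r `` {t}"
      unfolding sigma_set_def quotient_def by blast
    assume "?h A = ?h B"
    then have "?q `` {?F s} = ?q `` {?F t}"
      using st by (simp only: h)
    then have "(?F s, ?F t) \<in> ?q"
      by (simp only: eq_equiv_class_iff[OF equiv_sigma_rel FS[OF st(1)] FS[OF st(2)]])
    from equiv_class_eq[OF equiv_sigma_rel inj[OF st(1,2) this]] show "A = B"
      using st by simp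
  qed
  moreover have "?h ` sigma_set X dX x0 (real K) \<subseteq> sigma_set Y dY y0 (real L)"
  proof
    fix B assume "B \<in> ?h ` sigma_set X dX x0 (real K)"
    then obtain s where s: "s \<in> ?S" "B = ?h (?r `` {s})"
      unfolding sigma_set_def quotient_def by blast
    then show "B \<in> sigma_set Y dY y0 (real L)"
      unfolding sigma_set_def h[OF s(1)] s(2) by (intro quotientI FS)
  qed
  ultimately have "(card_of (sigma_set X dX x0 (real K)), card_of (sigma_set Y dY y0 (real L)))
      \<in> ordLeq"
    unfolding card_of_ordLeq[symmetric] by blast
  then show ?thesis
    using sigma_card_eq[OF K] sigma_card_eq[OF L]
    by (meson ordIso_ordLeq_trans ordIso_symmetric ordLeq_ordIso_trans)
qed

theorem theorem4p1:
  fixes X :: "'a set" and dX :: "'a \<Rightarrow> 'a \<Rightarrow> real" and x0 :: 'a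
    and Y :: "'b set" and dY :: "'b \<Rightarrow> 'b \<Rightarrow> real" and y0 :: 'b
  assumes "Metric_space X dX" and "Metric_space Y dY"
    and "x0 \<in> X" and "y0 \<in> Y"
    and "coarsely_equivalent X dX Y dY"
    and "sigma_stable X dX" and "sigma_stable Y dY"
  shows "(sigma_card X dX x0, sigma_card Y dY y0) \<in> ordIso"
proof -
  \<comment> \<open>The hypotheses give stability at some basepoint only; it is moved to the
    prescribed ones.\<close>
  have st: "sigma_stable_at X dX x0" "sigma_stable_at Y dY y0"
    using assms sigma_stable_at_change_base unfolding sigma_stable_def by metis+
  obtain f g where fg: "coarse_map X dX Y dY f" "coarse_map Y dY X dX g"
    and "close_maps X dX (g \<circ> f) id" "close_maps Y dY (f \<circ> g) id"
    using assms(5) unfolding coarsely_equivalent_def by blast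
  then have "(sigma_card X dX x0, sigma_card Y dY y0) \<in> ordLeq"
    "(sigma_card Y dY y0, sigma_card X dX x0) \<in> ordLeq"
    using sigma_card_le[OF assms(1-4) fg _ st]
      sigma_card_le[OF assms(2,1,4,3) fg(2,1) _ st(2,1)] by blast+
  then show ?thesis
    by (simp add: ordIso_iff_ordLeq)
qed

end
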